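(* Let $n\geq 1$ be an odd integer. The discrete cosine transform matrix $C_n$ of modulus $n$ has the nonvanishing minors property if and only if $n$ is prime or $n=1$.
   Context: A square matrix has the nonvanishing minors property if the determinant of every square submatrix (obtained by choosing any set of $k$ rows and any set of $k$ columns, $k\ge 1$, including the whole matrix and the $1\times1$ submatrices) is nonzero. For odd $n\ge 1$, the discrete cosine transform matrix $C_n$ of modulus $n$ is the $\frac{n+1}{2}\times\frac{n+1}{2}$ matrix with rows and columns indexed from $0$ to $(n-1)/2$ whose entry in row $r$ and column $s$ is $$(C_n)_{r,s}=\begin{cases}\sqrt{1/n} & \text{if } r=s=0,\\ \sqrt{2/n} & \text{if } r=0 \text{ or } s=0\text{, but not both},\\ \dfrac{2\cos(2\pi rs/n)}{\sqrt n} & \text{otherwise.}\end{cases}$$ *)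

theory Defs
  imports
    Complex_Main
    "HOL-Computational_Algebra.Primes"
    "Jordan_Normal_Form.Determinant"
    "Jordan_Normal_Form.DL_Submatrix"
begin

text \<open>Rows and columns are chosen as sets of indices, so repetitions are excluded and the
  submatrix inherits the order of the indices.\<close>

definition nonvanishing_minors :: "'a :: comm_ring_1 mat \<Rightarrow> bool" where
  "nonvanishing_minors A \<longleftrightarrow>
     square_mat A \<and>
     (\<forall>I J. I \<subseteq> {..<dim_row A} \<longrightarrow> J \<subseteq> {..<dim_col A} \<longrightarrow> card I = card J \<longrightarrow> card I \<ge> 1 \<longrightarrow>
        det (submatrix A I J) \<noteq> 0)"

text \<open>Meant for odd \<open>n\<close> only, where \<open>(n + 1) div 2\<close> is the exact quotient.\<close>

definition dct_matrix :: "nat \<Rightarrow> real mat" where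
  "dct_matrix n = mat ((n + 1) div 2) ((n + 1) div 2) (\<lambda>(r, s).
     if r = 0 \<and> s = 0 then sqrt (1 / real n)
     else if r = 0 \<or> s = 0 then sqrt (2 / real n)
     else 2 * cos (2 * pi * real r * real s / real n) / sqrt (real n))"

end

theory Submission
  imports
    Defs
    "Subresultants.Subresultant_Gcd"
    "HOL-Computational_Algebra.Field_as_Ring"
begin

text \<open>If \<open>n = a b\<close> is a proper factorization, then the angle in row \<open>a\<close> and column \<open>b\<close> is
  \<open>2 \<pi>\<close>, so the minor with rows \<open>0, a\<close> and columns \<open>0, b\<close> vanishes.

  For an odd prime \<open>p\<close> the argument follows Chebotarev's theorem on minors of the Fourier matrix.
  Let \<open>\<omega>\<close> be a primitive \<open>p\<close>-th root of unity. Up to scaling of rows and columns the entries are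
  \<open>\<omega>\<^sup>r\<^sup>s + \<omega>\<^sup>-\<^sup>r\<^sup>s\<close>, which is an integer polynomial \<open>Q\<^sub>r\<close> evaluated at
  \<open>y\<^sub>s = \<omega>\<^sup>s + \<omega>\<^sup>-\<^sup>s - 2\<close>. Expanding the \<open>Q\<^sub>r\<close> in the Newton basis of the nodes \<open>y\<^sub>s\<close> splits
  off the Vandermonde determinant of the distinct \<open>y\<^sub>s\<close>. If the minor vanishes, then so does the
  determinant of divided differences, an element of \<open>\<int>[\<omega>]\<close>. Specializing \<open>\<omega>\<close> to \<open>1\<close>, where all
  nodes become \<open>0\<close>, gives an integer determinant of Taylor coefficients of the \<open>Q\<^sub>r\<close> that is
  divisible by \<open>p\<close>. But up to factorials this determinant is \<open>2\<^sup>k\<close> times the Vandermonde determinant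
  of the \<open>r\<^sup>2\<close>, and \<open>p\<close> divides none of the factors \<open>r \<plusminus> r'\<close>.\<close>

subsection \<open>Newton interpolation and determinants\<close>

fun newton_quot :: "(nat \<Rightarrow> 'a) \<Rightarrow> nat \<Rightarrow> 'a :: comm_ring_1 poly \<Rightarrow> 'a poly" where
  "newton_quot x 0 f = f"
| "newton_quot x (Suc m) f = synthetic_div (newton_quot x m f) (x m)"

text \<open>The divided difference f[x_0, ..., x_m]. Synthetic division avoids quotients by node
  differences, so it makes sense in every commutative ring and for coinciding nodes, which the later
  specialization to 0 relies on.\<close>

definition newton_coeff :: "(nat \<Rightarrow> 'a) \<Rightarrow> nat \<Rightarrow> 'a :: comm_ring_1 poly \<Rightarrow> 'a" where
  "newton_coeff x m f = poly (newton_quot x m f) (x m)"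

lemma newton_expansion:
  "poly f z = (\<Sum>l<m. newton_coeff x l f * (\<Prod>i<l. z - x i))
     + poly (newton_quot x m f) z * (\<Prod>i<m. z - x i)"
proof (induction m)
  case (Suc m)
  let ?q = "newton_quot x m f"
  have "poly ?q z = poly ([:- x m, 1:] * synthetic_div ?q (x m) + [:poly ?q (x m):]) z"
    by (simp only: synthetic_div_correct')
  then have "poly ?q z = (z - x m) * poly (newton_quot x (Suc m) f) z + newton_coeff x m f"
    by (simp add: newton_coeff_def algebra_simps)
  with Suc.IH show ?case
    by (simp add: algebra_simps)
qed simp

lemma newton_interpolation:
  assumes "j < k"
  shows "poly f (x j) = (\<Sum>l<k. newton_coeff x l f * (\<Prod>i<l. x j - x i))"
proof -
  have "(\<Prod>i<k. x j - x i) = 0"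
    using assms by (intro prod_zero) auto
  then show ?thesis
    using newton_expansion[of f "x j" x k] by simp
qed

text \<open>Newton interpolation factors the matrix into divided differences times values of the
  Newton basis. The second factor is upper triangular, since the l-th basis polynomial vanishes at
  x_j for j < l.\<close>

lemma det_poly_eval:
  fixes f :: "nat \<Rightarrow> 'a :: comm_ring_1 poly"
  shows "det (mat k k (\<lambda>(i, j). poly (f i) (x j))) =
    det (mat k k (\<lambda>(i, l). newton_coeff x l (f i))) * (\<Prod>j<k. \<Prod>i<j. x j - x i)"
proof -
  let ?C = "mat k k (\<lambda>(i, l). newton_coeff x l (f i))"
  let ?N = "mat k k (\<lambda>(l, j). \<Prod>i<l. x j - x i)"
  have "mat k k (\<lambda>(i, j). poly (f i) (x j)) = ?C * ?N"
    by (rule eq_matI)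
      (auto simp: scalar_prod_def newton_interpolation[of _ k] lessThan_atLeast0 simp del: newton_quot.simps)
  moreover have "det ?N = (\<Prod>j<k. \<Prod>i<j. x j - x i)"
  proof -
    have "upper_triangular ?N"
    proof (rule upper_triangularI)
      fix i j assume "j < i" "i < dim_row ?N"
      moreover from this have "(\<Prod>m<i. x j - x m) = 0"
        by (intro prod_zero) auto
      ultimately show "?N $$ (i, j) = 0" by simp
    qed
    then have "det ?N = prod_list (diag_mat ?N)"
      by (rule det_upper_triangular[of _ k]) simp
    then show ?thesis
      by (simp add: prod_list_diag_prod lessThan_atLeast0)
  qed
  ultimately show ?thesis
    by (simp add: det_mult[of ?C k ?N])
qed

lemma (in comm_ring_hom) synthetic_div_hom:
  "synthetic_div (map_poly hom p) (hom c) = map_poly hom (synthetic_div p c)"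
proof (induction p)
  case (pCons a p)
  interpret mp: map_poly_comm_ring_hom hom ..
  show ?case using pCons.IH by (simp add: map_poly_pCons_hom)
qed simp

text \<open>Synthetic division uses ring operations only. This is applied below to the evaluations
  at the root of unity and at 1.\<close>

lemma (in comm_ring_hom) newton_coeff_hom:
  "newton_coeff (hom \<circ> x) m (map_poly hom f) = hom (newton_coeff x m f)"
proof -
  interpret mp: map_poly_comm_ring_hom hom ..
  have "newton_quot (hom \<circ> x) m (map_poly hom f) = map_poly hom (newton_quot x m f)"
    by (induction m) (simp_all add: synthetic_div_hom)
  then show ?thesis by (simp add: newton_coeff_def)
qed

text \<open>Synthetic division at 0 drops the constant coefficient and shifts the others
  down.\<close>

lemma newton_coeff_zero_nodes: "newton_coeff (\<lambda>_. 0) m f = coeff f m"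
proof -
  have *: "coeff (synthetic_div q 0) n = coeff q (Suc n)" for q :: "'a poly" and n
    using arg_cong[OF synthetic_div_correct[of q 0], of "\<lambda>p. coeff p (Suc n)"] by simp
  have "coeff (newton_quot (\<lambda>_. 0) m f) n = coeff f (n + m)" for n
    by (induction m arbitrary: n) (simp_all add: *)
  from this[of 0] show ?thesis by (simp add: newton_coeff_def poly_0_coeff_0)
qed

lemma lead_coeff_synthetic_div:
  fixes p :: "'a :: comm_ring_1 poly"
  assumes "degree p > 0"
  shows "lead_coeff (synthetic_div p c) = lead_coeff p"
proof -
  have "coeff (synthetic_div p c) (degree p) = 0"
    using assms by (intro coeff_eq_0) (simp add: degree_synthetic_div)
  with arg_cong[OF synthetic_div_correct[of p c], of "\<lambda>q. coeff q (degree p)"] assms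
  show ?thesis
    by (auto simp: degree_synthetic_div coeff_pCons split: nat.splits)
qed

text \<open>Each division by a linear factor lowers the degree by one and keeps the leading
  coefficient, so the quotient is 1 after d divisions and 0 afterwards.\<close>

lemma newton_coeff_monic:
  assumes "monic f" "degree f = d" "d \<le> m"
  shows "newton_coeff x m f = (if m = d then 1 else 0)"
proof -
  have "degree (newton_quot x i f) = d - i \<and> monic (newton_quot x i f)" if "i \<le> d" for i
    using that
  proof (induction i)
    case (Suc i)
    then have "degree (newton_quot x i f) > 0" "degree (newton_quot x i f) = d - i"
      "monic (newton_quot x i f)" by auto
    with lead_coeff_synthetic_div[OF this(1), of "x i"] show ?case
      by (simp add: degree_synthetic_div)
  qed (use assms in auto)
  from this[of d] have d: "newton_quot x d f = 1"
    using monic_degree_0 by auto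
  have "newton_quot x (Suc (d + i)) f = 0" for i
  proof (induction i)
    case 0
    show ?case using d by (simp add: synthetic_div_eq_0_iff)
  next
    case (Suc i)
    then show ?case by (metis add_Suc_right newton_quot.simps(2) synthetic_div_0)
  qed
  then have "newton_quot x m f = (if m = d then 1 else 0)"
    using assms(3) d less_imp_Suc_add[of d m] by (cases "m = d") (auto simp del: newton_quot.simps)
  then show ?thesis by (simp add: newton_coeff_def)
qed

lemma det_poly_eval_monic:
  fixes f :: "nat \<Rightarrow> 'a :: comm_ring_1 poly"
  assumes "\<And>i. i < k \<Longrightarrow> monic (f i) \<and> degree (f i) = i"
  shows "det (mat k k (\<lambda>(i, j). poly (f i) (x j))) = (\<Prod>j<k. \<Prod>i<j. x j - x i)"
proof -
  let ?C = "mat k k (\<lambda>(i, l). newton_coeff x l (f i))"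
  have C: "newton_coeff x l (f i) = (if l = i then 1 else 0)" if "i \<le> l" "l < k" for i l
    using assms[of i] that by (intro newton_coeff_monic) auto
  then have "det ?C = prod_list (diag_mat ?C)"
    by (intro det_lower_triangular[of k]) auto
  also have "\<dots> = 1"
    by (simp add: prod_list_diag_prod C)
  finally show ?thesis by (simp add: det_poly_eval)
qed

subsection \<open>Integer polynomials vanishing at a root of unity of prime order\<close>

text \<open>The resultant commutes with the embedding of the integers, so its vanishing carries the
  common factor over the complex numbers down to the integers.\<close>

lemma common_root_imp_degree_gcd:
  fixes f g :: "int poly" and z :: complex
  assumes "poly (of_int_poly f) z = 0" "poly (of_int_poly g) z = 0" "f \<noteq> 0"
  shows "degree (gcd f g) \<noteq> 0"
proof -
  let ?f = "of_int_poly f :: complex poly" and ?g = "of_int_poly g :: complex poly"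
  have "[:- z, 1:] dvd gcd ?f ?g"
    using assms by (simp add: poly_eq_0_iff_dvd)
  moreover have "gcd ?f ?g \<noteq> 0" using assms by simp
  ultimately have "degree (gcd ?f ?g) \<noteq> 0"
    using dvd_imp_degree_le[of "[:- z, 1:]" "gcd ?f ?g"] by auto
  then have "resultant ?f ?g = 0" by (simp add: resultant_0_gcd)
  then have "resultant f g = 0" by (simp add: of_int_hom.resultant_hom)
  then show ?thesis by (simp add: resultant_0_gcd)
qed

text \<open>The argument of Eisenstein's criterion, applied to the cyclotomic polynomial
  shifted to \<open>1 + t\<close>.\<close>

lemma factor_geometric_sum_prime:
  fixes g h :: "int poly"
  assumes p: "prime p" and gh: "(\<Sum>i<p. monom 1 i) = g * h" and deg: "degree g \<noteq> 0"
  shows "int p dvd poly g 1"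
proof (rule ccontr)
  assume ndvd: "\<not> int p dvd poly g 1"
  define G where "G = g \<circ>\<^sub>p [:1, 1:]"
  define H where "H = h \<circ>\<^sub>p [:1, 1:]"
  have binom: "coeff ([:1, 1:] ^ n :: int poly) i = int (n choose i)" for n i
    by (induction n arbitrary: i) (simp_all add: coeff_pCons split: nat.split)
  have p0: "p > 0" using p by (simp add: prime_gt_0_nat)
  have "G * H = (\<Sum>i<p. [:1, 1:] ^ i)"
    by (simp add: G_def H_def flip: pcompose_mult gh)
      (simp add: pcompose_sum monom_altdef pcompose_hom.hom_power pcompose_pCons)
  moreover have "[:1, 1:] - 1 = (pCons 0 1 :: int poly)"
    by (rule poly_eqI) (simp add: coeff_pCons split: nat.split)
  \<comment> \<open>The geometric series after the shift: t G H = (1 + t)^p - 1, so the coefficients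
    of G H are binomial coefficients.\<close>
  ultimately have eq: "pCons 0 (G * H) = [:1, 1:] ^ p - 1"
    using power_diff_1_eq[of "[:1, 1:] :: int poly" p] by simp
  have coeffs: "coeff (G * H) i = int (p choose Suc i)" for i
    using arg_cong[OF eq, of "\<lambda>q. coeff q (Suc i)"]
    by (simp only: coeff_pCons_Suc coeff_diff binom) simp
  have "int p dvd coeff (G * H) 0" using coeffs[of 0] by simp
  moreover have "G0": "coeff G 0 = poly g 1"
    by (simp add: G_def coeff_pcompose_0)
  ultimately have H0: "int p dvd coeff H 0"
    using ndvd p by (auto simp: coeff_mult_0 prime_dvd_mult_iff)
  \<comment> \<open>The coefficient of G H at p - 1 is 1, so p cannot divide every coefficient of
    H.\<close>
  have "\<exists>i. \<not> int p dvd coeff H i"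
  proof (rule ccontr)
    assume "\<nexists>i. \<not> int p dvd coeff H i"
    then have "int p dvd coeff (G * H) (p - 1)"
      by (auto simp: coeff_mult intro!: dvd_sum)
    then show False using coeffs[of "p - 1"] p p0 by (simp add: prime_nat_iff)
  qed
  then obtain i where i: "\<not> int p dvd coeff H i" and least: "\<And>j. j < i \<Longrightarrow> int p dvd coeff H j"
    using exists_least_iff[of "\<lambda>i. \<not> int p dvd coeff H i"] by blast
  have "coeff (G * H) i = (\<Sum>j\<le>i. coeff G j * coeff H (i - j))" by (rule coeff_mult)
  also have "{..i} = insert 0 {1..i}" by auto
  also have "(\<Sum>j\<in>\<dots>. coeff G j * coeff H (i - j))
      = coeff G 0 * coeff H i + (\<Sum>j\<in>{1..i}. coeff G j * coeff H (i - j))" by simp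
  finally have sum: "coeff (G * H) i = coeff G 0 * coeff H i + (\<Sum>j\<in>{1..i}. coeff G j * coeff H (i - j))" .
  have "int p dvd (\<Sum>j\<in>{1..i}. coeff G j * coeff H (i - j))"
    by (intro dvd_sum dvd_mult least) auto
  moreover have "\<not> int p dvd coeff G 0 * coeff H i"
    using i ndvd p by (simp add: G0 prime_dvd_mult_iff)
  ultimately have "\<not> int p dvd coeff (G * H) i"
    unfolding sum by (simp add: dvd_add_left_iff)
  then have "\<not> p dvd p choose Suc i" by (simp add: coeffs)
  \<comment> \<open>Hence i >= p - 1, so H already has the full degree of G H and G is
    constant.\<close>
  then have "\<not> Suc i < p" using dvd_choose_prime[of "Suc i" p] p p0 by auto
  moreover have "i \<le> degree H" using i by (intro le_degree) auto
  moreover have "degree (G * H) \<le> p - 1"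
    by (rule degree_le) (auto simp: coeffs binomial_eq_0)
  moreover have "G * H \<noteq> 0"
    using coeffs[of "p - 1"] p0 by auto
  then have "degree (G * H) = degree G + degree H" by (simp add: degree_mult_eq)
  moreover have "degree G = degree g" by (simp add: G_def)
  ultimately show False using deg p0 by linarith
qed

text \<open>The gcd of q with 1 + t + ... + t^(p-1) is a nonconstant factor of the latter, so p
  divides its value at 1, which in turn divides that of q.\<close>

lemma root_of_unity_root_imp_dvd:
  fixes q :: "int poly" and w :: complex
  assumes p: "prime p" and w: "w ^ p = 1" "w \<noteq> 1" and q: "poly (of_int_poly q) w = 0"
  shows "int p dvd poly q 1"
proof -
  let ?f = "\<Sum>i<p. monom 1 i :: int poly"
  have "(\<Sum>i<p. w ^ i) = 0"
    using power_diff_1_eq[of w p] w by simp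
  then have "poly (of_int_poly ?f) w = 0"
    by (simp add: of_int_poly_hom.hom_sum poly_sum poly_monom)
  moreover have "poly ?f 1 = int p" by (simp add: poly_sum poly_monom)
  then have "?f \<noteq> 0" using p by (metis of_nat_eq_0_iff not_prime_0 poly_0)
  ultimately have deg: "degree (gcd ?f q) \<noteq> 0"
    using q by (intro common_root_imp_degree_gcd)
  obtain h where "?f = gcd ?f q * h" by (metis gcd_dvd1 dvdE)
  from factor_geometric_sum_prime[OF p this deg] have "int p dvd poly (gcd ?f q) 1" .
  also have "\<dots> dvd poly q 1" by (intro poly_hom.hom_dvd) simp
  finally show ?thesis .
qed

subsection \<open>Chebyshev polynomials around \<open>1\<close>\<close>

text \<open>In terms of the Chebyshev polynomials of the first kind this is \<open>2 T\<^sub>r (1 + y / 2)\<close>.\<close>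

fun chebyshev_poly :: "nat \<Rightarrow> int poly" where
  "chebyshev_poly 0 = [:2:]"
| "chebyshev_poly (Suc 0) = [:2, 1:]"
| "chebyshev_poly (Suc (Suc r)) = [:2, 1:] * chebyshev_poly (Suc r) - chebyshev_poly r"

lemma poly_chebyshev_poly:
  fixes z w :: "'a :: comm_ring_1"
  assumes "z * w = 1"
  shows "poly (of_int_poly (chebyshev_poly r)) (z + w - 2) = z ^ r + w ^ r"
proof (induction r rule: chebyshev_poly.induct)
  case (3 r)
  have "poly (of_int_poly (chebyshev_poly (Suc (Suc r)))) (z + w - 2)
      = (z + w) * (z ^ Suc r + w ^ Suc r) - (z ^ r + w ^ r)"
    using 3 by (simp add: hom_distribs algebra_simps)
  also have "\<dots> = z ^ Suc (Suc r) + w ^ Suc (Suc r) + (z * w - 1) * (z ^ r + w ^ r)"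
    by (simp add: algebra_simps)
  finally show ?case by (simp add: assms)
qed simp_all

text \<open>Monic of degree l in x^2. For natural x, this times 2 / (2l)! is the l-th coefficient of
  \<open>chebyshev_poly x\<close>.\<close>

definition sq_prod :: "nat \<Rightarrow> int \<Rightarrow> int" where
  "sq_prod l x = (\<Prod>j<l. x\<^sup>2 - (int j)\<^sup>2)"

lemma sq_prod_Suc: "sq_prod (Suc l) x = x * (x * (\<Prod>j<l. x\<^sup>2 - (int (Suc j))\<^sup>2))"
  unfolding sq_prod_def by (subst prod.lessThan_Suc_shift) (simp add: power2_eq_square)

text \<open>Both sides are the product of x + i for i from -l to l + 2.\<close>

lemma sq_prod_shift:
  "(x + 1) * (\<Prod>j<Suc l. (x + 1)\<^sup>2 - (int (Suc j))\<^sup>2)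
    = x * (\<Prod>j<l. x\<^sup>2 - (int (Suc j))\<^sup>2) * (x + int l + 1) * (x + int l + 2)"
proof (induction l)
  case (Suc l)
  define W where "W = (\<Prod>j<l. x\<^sup>2 - (int (Suc j))\<^sup>2)"
  define V where "V = (\<Prod>j<Suc l. (x + 1)\<^sup>2 - (int (Suc j))\<^sup>2)"
  have "(x + 1) * V = x * W * (x + int l + 1) * (x + int l + 2)"
    using Suc by (simp only: V_def W_def)
  then have "(x + 1) * V * ((x + 1)\<^sup>2 - (int l + 2)\<^sup>2)
      = x * W * (x + int l + 1) * (x + int l + 2) * ((x + 1)\<^sup>2 - (int l + 2)\<^sup>2)"
    by simp
  also have "\<dots> = x * W * (x\<^sup>2 - (int l + 1)\<^sup>2) * (x + int l + 2) * (x + int l + 3)"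
    by (simp add: power2_eq_square algebra_simps)
  finally have fin: "(x + 1) * V * ((x + 1)\<^sup>2 - (int l + 2)\<^sup>2)
      = x * W * (x\<^sup>2 - (int l + 1)\<^sup>2) * (x + int l + 2) * (x + int l + 3)" .
  have "(\<Prod>j<Suc (Suc l). (x + 1)\<^sup>2 - (int (Suc j))\<^sup>2) = V * ((x + 1)\<^sup>2 - (int l + 2)\<^sup>2)"
    unfolding V_def by (subst prod.lessThan_Suc) (simp add: algebra_simps)
  moreover have "(\<Prod>j<Suc l. x\<^sup>2 - (int (Suc j))\<^sup>2) = W * (x\<^sup>2 - (int l + 1)\<^sup>2)"
    unfolding W_def by (subst prod.lessThan_Suc) (simp add: algebra_simps)
  moreover have "x + int (Suc l) + 1 = x + int l + 2" "x + int (Suc l) + 2 = x + int l + 3"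
    by simp_all
  ultimately show ?case using fin by (simp only: mult.assoc)
qed (simp add: power2_eq_square algebra_simps)

text \<open>The counterpart, for coefficients, of the Chebyshev recurrence in the form Q_(r+2) - 2
  Q_(r+1) + Q_r = y Q_(r+1).\<close>

lemma sq_prod_second_difference:
  "sq_prod (Suc l) (x + 1) - 2 * sq_prod (Suc l) x + sq_prod (Suc l) (x - 1)
    = (2 * int l + 2) * (2 * int l + 1) * sq_prod l x"
proof (cases l)
  case 0
  then show ?thesis by (simp add: sq_prod_def power2_eq_square algebra_simps)
next
  case (Suc m)
  define W where "W = (\<Prod>j<m. x\<^sup>2 - (int (Suc j))\<^sup>2)"
  have 1: "sq_prod (Suc l) (x + 1) = (x + 1) * (x * W * (x + int m + 1) * (x + int m + 2))"
    unfolding Suc sq_prod_Suc[of "Suc m"] sq_prod_shift W_def ..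
  \<comment> \<open>The value at x - 1 comes from the shift at -x, since W depends on x^2
    only.\<close>
  have "(1 - x) * (\<Prod>j<Suc m. (1 - x)\<^sup>2 - (int (Suc j))\<^sup>2)
      = - x * W * (- x + int m + 1) * (- x + int m + 2)"
    using sq_prod_shift[of "- x" m] by (simp add: W_def)
  moreover have "(x - 1) * P = - ((1 - x) * P)" for P
    by (simp add: algebra_simps)
  ultimately have "(x - 1) * (\<Prod>j<Suc m. (x - 1)\<^sup>2 - (int (Suc j))\<^sup>2)
      = x * W * (- x + int m + 1) * (- x + int m + 2)"
    by (simp only: power2_commute[of 1 x])
  then have 2: "sq_prod (Suc l) (x - 1) = (x - 1) * (x * W * (- x + int m + 1) * (- x + int m + 2))"
    unfolding Suc sq_prod_Suc[of "Suc m"] by simp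
  have 3: "sq_prod (Suc l) x = x * (x * (W * (x\<^sup>2 - (int m + 1)\<^sup>2)))"
    unfolding Suc sq_prod_Suc[of "Suc m"] by (simp add: W_def algebra_simps)
  have 4: "sq_prod l x = x * (x * W)"
    unfolding Suc sq_prod_Suc W_def ..
  show ?thesis
    unfolding 1 2 3 4 by (simp add: Suc power2_eq_square algebra_simps)
qed

lemma coeff_chebyshev_poly:
  "fact (2 * l) * coeff (chebyshev_poly r) l = 2 * sq_prod l (int r)"
proof (induction r arbitrary: l rule: chebyshev_poly.induct)
  case 1
  show ?case by (cases l) (simp_all add: sq_prod_Suc sq_prod_def[of 0])
next
  case 2
  have "sq_prod (Suc (Suc m)) 1 = 0" for m
    by (simp add: sq_prod_Suc prod.lessThan_Suc_shift del: prod.lessThan_Suc)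
  moreover have "sq_prod 0 1 = 1" "sq_prod (Suc 0) 1 = 1"
    by (simp_all add: sq_prod_def)
  ultimately show ?case
    by (cases l rule: nat.exhaust[case_names 0 Suc]) (auto simp: coeff_pCons gr0_conv_Suc split: nat.split)
next
  case (3 r)
  show ?case
  proof (cases l)
    case 0
    then show ?thesis using 3[of 0] by (simp add: sq_prod_def)
  next
    case (Suc m)
    have f: "fact (2 * l) = (2 * int m + 2) * (2 * int m + 1) * fact (2 * m)"
      by (simp add: Suc algebra_simps)
    have "fact (2 * l) * coeff (chebyshev_poly (Suc (Suc r))) l
        = 2 * (fact (2 * l) * coeff (chebyshev_poly (Suc r)) l)
          + fact (2 * l) * coeff (chebyshev_poly (Suc r)) m
          - fact (2 * l) * coeff (chebyshev_poly r) l"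
      by (simp add: Suc algebra_simps)
    also have "fact (2 * l) * coeff (chebyshev_poly (Suc r)) m
        = (2 * int m + 2) * (2 * int m + 1) * (2 * sq_prod m (int (Suc r)))"
      unfolding f 3(1)[of m, symmetric] by (simp only: mult.assoc)
    also note 3(1)[of l] also note 3(2)[of l]
    also have "2 * (2 * sq_prod l (int (Suc r))) + (2 * int m + 2) * (2 * int m + 1) * (2 * sq_prod m (int (Suc r)))
        - 2 * sq_prod l (int r) = 2 * sq_prod l (int (Suc (Suc r)))"
      using sq_prod_second_difference[of m "int (Suc r)"] by (simp add: Suc algebra_simps)
    finally show ?thesis .
  qed
qed

subsection \<open>Minors of the cosine transform matrix\<close>

lemma det_scale:
  fixes a b :: "nat \<Rightarrow> 'a :: comm_ring_1"
  shows "det (mat k k (\<lambda>(i, j). a i * b j * M i j))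
    = (\<Prod>i<k. a i) * (\<Prod>j<k. b j) * det (mat k k (\<lambda>(i, j). M i j))"
proof -
  have "(\<Prod>i = 0..<k. a i * b (q i) * M i (q i))
      = (\<Prod>i<k. a i) * (\<Prod>j<k. b j) * (\<Prod>i = 0..<k. M i (q i))"
    if "q permutes {0..<k}" for q
    using prod.permute[OF that, of b] by (simp add: prod.distrib lessThan_atLeast0 o_def)
  moreover have "q i < k" if "q permutes {0..<k}" "i < k" for q i
    using permutes_in_image[OF that(1), of i] that(2) by simp
  ultimately show ?thesis
    by (simp add: det_def'[of _ k] sum_distrib_left cong: sum.cong prod.cong) (auto intro!: sum.cong)
qed

lemma dim_dct_matrix [simp]:
  "dim_row (dct_matrix n) = (n + 1) div 2" "dim_col (dct_matrix n) = (n + 1) div 2"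
  by (simp_all add: dct_matrix_def)

section \<open>Composite moduli\<close>

lemma nonvanishing_minors_dct_imp_prime:
  assumes "odd n" "n \<noteq> 1" "nonvanishing_minors (dct_matrix n)"
  shows "prime n"
proof (rule ccontr)
  assume "\<not> prime n"
  moreover have "n > 1" using assms by (cases n) auto
  ultimately obtain a where a: "a dvd n" "a \<noteq> 1" "a \<noteq> n"
    by (auto simp: prime_nat_iff)
  then obtain b where ab: "n = a * b" by (elim dvdE)
  with a assms have odd: "odd a" "odd b" "a \<noteq> 1" "b \<noteq> 1" by auto
  \<comment> \<open>With both factors at least 3, a and b are at most n / 3 and hence valid
    indices.\<close>
  then have ge: "a \<ge> 3" "b \<ge> 3"
    by (auto elim!: oddE)
  have small: "a < (n + 1) div 2" "b < (n + 1) div 2"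
    using mult_le_mono2[OF ge(2), of a] mult_le_mono1[OF ge(1), of b] ab ge by linarith+
  let ?A = "submatrix (dct_matrix n) {0, a} {0, b}"
  have card: "card {i. i < (n + 1) div 2 \<and> i \<in> {0, c}} = 2" if "0 < c" "c < (n + 1) div 2" for c
  proof -
    have "{i. i < (n + 1) div 2 \<and> i \<in> {0, c}} = {0, c}" using that by auto
    then show ?thesis using that by simp
  qed
  have pick0: "pick {0, c} 0 = 0" for c
    using pick_card_in_set[of 0 "{0, c}"] by simp
  have pick1: "pick {0, c} 1 = c" if "0 < c" for c
  proof -
    have "{x \<in> {0, c}. x < c} = {0}" using that by auto
    then show ?thesis using pick_card_in_set[of c "{0, c}"] by simp
  qed
  have dimA: "?A \<in> carrier_mat 2 2"
    using ge small by (intro carrier_matI) (simp_all only: dim_submatrix dim_dct_matrix card)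
  have entry: "?A $$ (i, j) = dct_matrix n $$ (pick {0, a} i, pick {0, b} j)" if "i < 2" "j < 2" for i j
    using ge small that by (intro submatrix_index) (simp_all only: dim_dct_matrix card)
  have angle: "2 * pi * real a * real b / real n = 2 * pi" using ab ge by simp
  \<comment> \<open>In rows 0 and a, column b is sqrt 2 times column 0, which yields this kernel
    vector.\<close>
  let ?v = "vec 2 (\<lambda>i. if i = 0 then sqrt 2 else - 1) :: real vec"
  have "?v $ 0 \<noteq> 0\<^sub>v 2 $ 0" by simp
  then have "?v \<noteq> 0\<^sub>v 2" by metis
  moreover have "?A *\<^sub>v ?v = 0\<^sub>v 2"
  proof (rule eq_vecI)
    fix i assume "i < dim_vec (0\<^sub>v 2 :: real vec)"
    then have "i = 0 \<or> i = 1" by auto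
    moreover have "(?A *\<^sub>v ?v) $ i = dct_matrix n $$ (pick {0, a} i, 0) * sqrt 2
        - dct_matrix n $$ (pick {0, a} i, b)" if "i < 2" for i
      using that carrier_matD[OF dimA] entry[of i 0] entry[of i 1] pick0 pick1 ge
      by (simp add: scalar_prod_def numeral_2_eq_2)
    ultimately show "(?A *\<^sub>v ?v) $ i = 0\<^sub>v 2 $ i"
      using pick0 pick1 ge small angle
      by (auto simp: dct_matrix_def real_sqrt_divide)
  qed (use carrier_matD[OF dimA] in simp)
  ultimately have "det ?A = 0"
    using det_0_iff_vec_prod_zero_field[OF dimA] by (metis vec_carrier)
  moreover have "det ?A \<noteq> 0"
    using assms(3) small ge unfolding nonvanishing_minors_def by (auto simp: card_insert_if)
  ultimately show False by simp
qed

section \<open>Prime moduli\<close>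

lemma not_dvd_det_coeff_chebyshev:
  assumes p: "prime p" "odd p"
    and r: "\<And>i j. i < j \<Longrightarrow> j < k \<Longrightarrow> r i < r j" "\<And>i. i < k \<Longrightarrow> 2 * r i < p"
  shows "\<not> int p dvd det (mat k k (\<lambda>(i, l). coeff (chebyshev_poly (r i)) l))"
proof
  let ?B = "mat k k (\<lambda>(i, l). coeff (chebyshev_poly (r i)) l)"
  \<comment> \<open>This is \<open>sq_prod l\<close> as a polynomial in the square of its argument,
    so the Vandermonde formula for monic polynomials applies at the nodes
    \<open>x i\<close>.\<close>
  define f where "f l = (\<Prod>j<l. [:- (int j)\<^sup>2, 1:])" for l
  define x where "x i = (int (r i))\<^sup>2" for i
  have monic_f: "monic (f l)" for l
    unfolding f_def by (intro monic_prod) auto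
  have deg_f: "degree (f l) = l" for l
    unfolding f_def by (subst degree_prod_eq_sum_degree) auto
  have eval_f: "poly (f l) (x i) = sq_prod l (int (r i))" for l i
    by (simp add: f_def x_def sq_prod_def poly_prod)
  let ?E = "mat k k (\<lambda>(l, i). poly (f l) (x i))"
  assume "int p dvd det ?B"
  then have "int p dvd (\<Prod>i<k. 1) * (\<Prod>l<k. fact (2 * l)) * det ?B" by simp
  also have "\<dots> = det (mat k k (\<lambda>(i, l). 1 * fact (2 * l) * coeff (chebyshev_poly (r i)) l))"
    by (rule det_scale[symmetric])
  also have "\<dots> = det (mat k k (\<lambda>(i, l). 2 * 1 * poly (f l) (x i)))"
    by (simp add: coeff_chebyshev_poly eval_f)
  also have "\<dots> = (\<Prod>i<k. 2) * (\<Prod>l<k. 1) * det (mat k k (\<lambda>(i, l). poly (f l) (x i)))"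
    by (rule det_scale)
  also have "mat k k (\<lambda>(i, l). poly (f l) (x i)) = transpose_mat ?E"
    by (rule eq_matI) auto
  also have "det (transpose_mat ?E) = det ?E"
    by (rule det_transpose[of _ k]) simp
  also have "det ?E = (\<Prod>j<k. \<Prod>i<j. x j - x i)"
    by (rule det_poly_eval_monic) (metis monic_f deg_f)
  finally have "int p dvd 2 ^ k * (\<Prod>j<k. \<Prod>i<j. x j - x i)" by simp
  moreover have "\<not> int p dvd 2 ^ k"
  proof
    assume "int p dvd 2 ^ k"
    then have "p dvd 2"
      using p(1) by (metis int_dvd_int_iff of_nat_numeral prime_dvd_power prime_nat_int_transfer)
    with p show False by (metis dvd_refl primes_dvd_imp_eq two_is_prime_nat)
  qed
  ultimately have "int p dvd (\<Prod>j<k. \<Prod>i<j. x j - x i)"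
    using p(1) by (simp add: prime_dvd_mult_iff)
  then obtain i j where ij: "i < j" "j < k" "int p dvd x j - x i"
    using p(1) by (auto simp: prime_dvd_prod_iff)
  have "x j - x i = int (r j - r i) * int (r j + r i)"
    using r(1)[OF ij(1,2)] by (simp add: x_def power2_eq_square algebra_simps of_nat_diff)
  with ij(3) p(1) have "p dvd r j - r i \<or> p dvd r j + r i"
    by (simp add: prime_dvd_mult_iff del: of_nat_add flip: of_nat_mult)
  \<comment> \<open>The bound 2 * r i < p places both factors strictly between 0 and p.\<close>
  moreover have "0 < r j - r i" "r j - r i < p" "0 < r j + r i" "r j + r i < p"
    using r(1)[OF ij(1,2)] r(2)[of i] r(2)[of j] ij by linarith+
  ultimately show False by (metis nat_dvd_not_less)
qed

lemma det_cos_neq_0: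
  assumes p: "prime p" "odd p"
    and r: "\<And>i j. i < j \<Longrightarrow> j < k \<Longrightarrow> r i < r j" "\<And>i. i < k \<Longrightarrow> 2 * r i < p"
    and s: "\<And>i j. i < j \<Longrightarrow> j < k \<Longrightarrow> s i < s j" "\<And>i. i < k \<Longrightarrow> 2 * s i < p"
  shows "det (mat k k (\<lambda>(i, j). 2 * cos (2 * pi * real (r i) * real (s j) / real p))) \<noteq> 0"
    (is "det ?M \<noteq> 0")
proof
  assume det0: "det ?M = 0"
  define w where "w = cis (2 * pi / real p)"
  \<comment> \<open>Elements of Z[w] are represented by integer polynomials, with exponent p - s j
    standing for -s j. The node is 2 cos (2 pi s_j / p) - 2 at w, but 0 at 1.\<close>
  define x where "x j = (monom 1 (s j) + monom 1 (p - s j) - 2 :: int poly)" for j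
  \<comment> \<open>Coefficients are lifted to constant polynomials, so that divided differences are
    formed in one ring with homomorphisms \<open>at_w\<close> and \<open>at_1\<close>.\<close>
  define f where "f i = map_poly (\<lambda>c. [:c:]) (chebyshev_poly (r i))" for i
  define at_1 where "at_1 q = poly q 1" for q :: "int poly"
  define at_w where "at_w q = poly (of_int_poly q) w" for q :: "int poly"
  have p1: "p > 1" using p(1) by (rule prime_gt_1_nat)
  interpret at_1: comm_ring_hom at_1
    by unfold_locales (simp_all add: at_1_def)
  interpret at_w: comm_ring_hom at_w
    by unfold_locales (simp_all add: at_w_def hom_distribs)
  define D where "D = det (mat k k (\<lambda>(i, l). newton_coeff x l (f i)))"

  have w_pow: "w ^ m = cis (2 * pi * real m / real p)" for m
    by (simp add: w_def DeMoivre mult_ac)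
  have w_p: "w ^ p = 1" using p1 by (simp add: w_pow)
  have w_1: "w \<noteq> 1"
  proof
    assume "w = 1"
    then have "cos (2 * pi / real p) = cos 0" "sin (2 * pi / real p) = 0"
      by (simp_all add: w_def complex_eq_iff)
    moreover have "0 < pi / real p" "2 * pi / real p \<le> pi"
      using p1 by (simp_all add: field_simps)
    ultimately show False
      using cos_inj_pi[of "2 * pi / real p" 0] by simp
  qed
  have at_w_x: "at_w (x j) = w ^ s j + w ^ (p - s j) - 2" for j
    by (simp add: at_w_def x_def hom_distribs poly_monom)
  have w_inv: "w ^ s j * w ^ (p - s j) = 1" if "j < k" for j
    using s(2)[OF that] w_p by (simp flip: power_add)
  have w_conj: "w ^ (p - s j) = cis (- (2 * pi * real (s j) / real p))" if "j < k" for j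
    using w_inv[OF that] unfolding w_pow[of "s j"]
    by (metis cis_inverse inverse_unique)
  have at_w_x_cos: "at_w (x j) = complex_of_real (2 * cos (2 * pi * real (s j) / real p) - 2)" if "j < k" for j
    unfolding at_w_x w_conj[OF that] w_pow[of "s j"] by (simp add: complex_eq_iff)

  have "map_mat complex_of_real ?M = mat k k (\<lambda>(i, j). poly (of_int_poly (chebyshev_poly (r i))) ((at_w \<circ> x) j))"
  proof (rule eq_matI; simp)
    fix i j assume ij: "i < k" "j < k"
    have "(w ^ s j) ^ r i + (w ^ (p - s j)) ^ r i = complex_of_real (2 * cos (2 * pi * real (r i) * real (s j) / real p))"
      unfolding w_conj[OF ij(2)] w_pow[of "s j"] by (simp add: DeMoivre complex_eq_iff mult_ac)
    then show "2 * complex_of_real (cos (2 * pi * real (r i) * real (s j) / real p))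
        = poly (of_int_poly (chebyshev_poly (r i))) (at_w (x j))"
      unfolding at_w_x poly_chebyshev_poly[OF w_inv[OF ij(2)]] by simp
  qed
  also have "det \<dots> = det (mat k k (\<lambda>(i, l). newton_coeff (at_w \<circ> x) l (of_int_poly (chebyshev_poly (r i)))))
      * (\<Prod>j<k. \<Prod>i<j. at_w (x j) - at_w (x i))"
    by (subst det_poly_eval) simp
  also have "mat k k (\<lambda>(i, l). newton_coeff (at_w \<circ> x) l (of_int_poly (chebyshev_poly (r i))))
      = map_mat at_w (mat k k (\<lambda>(i, l). newton_coeff x l (f i)))"
  proof -
    have "map_poly at_w (f i) = of_int_poly (chebyshev_poly (r i))" for i
      by (simp add: f_def map_poly_map_poly o_def at_w_def hom_distribs)
    then show ?thesis
      by (intro eq_matI) (simp_all flip: at_w.newton_coeff_hom)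
  qed
  finally have "det (map_mat complex_of_real ?M) = at_w D * (\<Prod>j<k. \<Prod>i<j. at_w (x j) - at_w (x i))"
    by (simp add: D_def)
  \<comment> \<open>The angles lie in [0, pi], where the cosine is injective; so the Vandermonde
    factor is nonzero and \<open>at_w D\<close> must vanish.\<close>
  moreover have "at_w (x j) \<noteq> at_w (x i)" if "i < j" "j < k" for i j
  proof
    assume "at_w (x j) = at_w (x i)"
    then have "cos (2 * pi * real (s j) / real p) = cos (2 * pi * real (s i) / real p)"
      using that by (simp add: at_w_x_cos del: of_real_diff of_real_mult)
    moreover have range: "0 \<le> 2 * pi * real (s m) / real p \<and> 2 * pi * real (s m) / real p \<le> pi" if "m < k" for m
      using s(2)[OF that] p1 by (simp add: field_simps)
    ultimately have "2 * pi * real (s j) / real p = 2 * pi * real (s i) / real p"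
      using range[OF that(2)] range[OF less_trans[OF that]] cos_inj_pi by blast
    then show False using s(1)[OF that] p1 by simp
  qed
  ultimately have "at_w D = 0"
    using det0 by (auto simp: of_real_hom.hom_det)
  then have "int p dvd at_1 D"
    unfolding at_w_def at_1_def by (rule root_of_unity_root_imp_dvd[OF p(1) w_p w_1])
  also have "at_1 D = det (map_mat at_1 (mat k k (\<lambda>(i, l). newton_coeff x l (f i))))"
    by (simp add: D_def)
  also have "map_mat at_1 (mat k k (\<lambda>(i, l). newton_coeff x l (f i)))
      = mat k k (\<lambda>(i, l). coeff (chebyshev_poly (r i)) l)"
  proof -
    have "map_poly at_1 (f i) = chebyshev_poly (r i)" for i
      by (simp add: f_def map_poly_map_poly o_def at_1_def)
    moreover have "at_1 \<circ> x = (\<lambda>_. 0)"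
      by (auto simp: at_1_def x_def poly_monom)
    ultimately show ?thesis
      by (intro eq_matI) (simp_all add: newton_coeff_zero_nodes flip: at_1.newton_coeff_hom)
  qed
  finally have "int p dvd det (mat k k (\<lambda>(i, l). coeff (chebyshev_poly (r i)) l))" .
  moreover have "\<not> int p dvd det (mat k k (\<lambda>(i, l). coeff (chebyshev_poly (r i)) l))"
    by (rule not_dvd_det_coeff_chebyshev) (use p r in \<open>simp_all\<close>)
  ultimately show False by contradiction
qed

text \<open>The factor 1 / sqrt 2 for index 0 absorbs the special normalization of row and column 0,
  so that all entries become 2 cos (...) after scaling.\<close>

lemma det_submatrix_dct:
  fixes I J :: "nat set"
  assumes "I \<subseteq> {..<(n + 1) div 2}" "J \<subseteq> {..<(n + 1) div 2}" "card I = k" "card J = k" "n > 0"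
  defines "c \<equiv> \<lambda>r. if r = 0 then 1 / sqrt 2 else 1 :: real"
  shows "det (submatrix (dct_matrix n) I J) =
    (\<Prod>i<k. c (pick I i) / sqrt (real n)) * (\<Prod>j<k. c (pick J j))
      * det (mat k k (\<lambda>(i, j). 2 * cos (2 * pi * real (pick I i) * real (pick J j) / real n)))"
proof -
  have card: "{i. i < (n + 1) div 2 \<and> i \<in> I} = I" "{i. i < (n + 1) div 2 \<and> i \<in> J} = J"
    using assms(1,2) by auto
  have pick_less: "pick I i < (n + 1) div 2" "pick J i < (n + 1) div 2" if "i < k" for i
    using assms(1-4) that pick_in_set[of i I] pick_in_set[of i J] by auto
  have entry: "dct_matrix n $$ (a, b) = c a / sqrt (real n) * c b * (2 * cos (2 * pi * real a * real b / real n))"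
    if "a < (n + 1) div 2" "b < (n + 1) div 2" for a b
    using that assms(5) by (simp add: dct_matrix_def c_def real_sqrt_divide real_div_sqrt field_simps)
  have "submatrix (dct_matrix n) I J = mat k k (\<lambda>(i, j). c (pick I i) / sqrt (real n) * c (pick J j)
      * (2 * cos (2 * pi * real (pick I i) * real (pick J j) / real n)))"
    using assms(3,4)
    by (intro eq_matI) (simp_all add: submatrix_def card[simplified] entry pick_less[simplified])
  then show ?thesis by (simp only: det_scale)
qed

lemma nonvanishing_minors_dct_prime:
  assumes p: "prime p" "odd p"
  shows "nonvanishing_minors (dct_matrix p)"
  unfolding nonvanishing_minors_def
proof (intro conjI allI impI)
  fix I J :: "nat set"
  assume "I \<subseteq> {..<dim_row (dct_matrix p)}" "J \<subseteq> {..<dim_col (dct_matrix p)}" and card: "card I = card J"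
  then have sub: "I \<subseteq> {..<(p + 1) div 2}" "J \<subseteq> {..<(p + 1) div 2}"
    by simp_all
  have small: "2 * pick S i < p" if "S \<subseteq> {..<(p + 1) div 2}" "i < card S" for S i
    using pick_in_set[of i S] that p(2) by (auto elim!: oddE)
  have "det (mat (card I) (card I) (\<lambda>(i, j). 2 * cos (2 * pi * real (pick I i) * real (pick J j) / real p))) \<noteq> 0"
    by (rule det_cos_neq_0[OF p]) (use sub card in \<open>simp_all add: pick_mono small\<close>)
  then show "det (submatrix (dct_matrix p) I J) \<noteq> 0"
    using p(1) by (subst det_submatrix_dct[OF sub refl card[symmetric]]) (auto simp: prime_gt_0_nat)
qed simp

lemma nonvanishing_minors_dct_1: "nonvanishing_minors (dct_matrix 1)"
  unfolding nonvanishing_minors_def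
proof (intro conjI allI impI)
  fix I J :: "nat set"
  assume sub: "I \<subseteq> {..<dim_row (dct_matrix 1)}" "J \<subseteq> {..<dim_col (dct_matrix 1)}"
    and card: "card I = card J" "card I \<ge> 1"
  have "{..<1} = {0 :: nat}" by auto
  with sub have "I \<subseteq> {0}" "J \<subseteq> {0}"
    by simp_all
  moreover have "I \<noteq> {}" "J \<noteq> {}"
    using card by auto
  ultimately have IJ: "I = {0}" "J = {0}"
    by blast+
  have "pick {0} 0 = (0 :: nat)"
    using pick_card_in_set[of 0 "{0}"] by simp
  then have "det (submatrix (dct_matrix 1) I J) = 2 * (1 / sqrt 2 * (1 / sqrt 2))"
    unfolding IJ by (subst det_submatrix_dct[where k = 1]) (auto simp: det_single)
  then show "det (submatrix (dct_matrix 1) I J) \<noteq> 0" by simp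
qed simp

theorem theorem1p2:
  fixes n :: nat
  assumes "n \<ge> 1" and "odd n"
  shows "nonvanishing_minors (dct_matrix n) \<longleftrightarrow> prime n \<or> n = 1"
  using nonvanishing_minors_dct_imp_prime[OF assms(2)] nonvanishing_minors_dct_prime[OF _ assms(2)]
    nonvanishing_minors_dct_1
  by metis

end
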